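(* Let $(\mathcal{G},\{\Phi_v\},\{l_v\})$ be a computational structure with objective $f$ and constraint functions $\mathbf{h}_v$ as in the context, all $\Phi_v$ and $l_v$ being twice continuously differentiable. Let $\mathtt{X}_V=(\mathtt{X}_v)_{v\in V[\mathcal{G}]}$ be feasible for the constrained problem, i.e. $\mathtt{X}_v=\Phi_v(\mathtt{X}_{\mathrm{pa}(v)})$ for every non-input vertex $v$, and let the multipliers be $\lambda_v=\partial_v f$ for every non-input vertex $v$, where $\partial_v f$ is the total derivative defined in the context, evaluated at $\mathtt{X}_V$. Then the Newton direction of the unconstrained problem at $\mathtt{X}_{\mathrm{Input}}$ is given by an iteration of SQP for the constrained problem at $(\mathtt{X}_V,\lambda)$. That is, a vector $\delta\mathtt{X}_{\mathrm{Input}}$ satisfies the Newton equation $$\nabla^2 f(\mathtt{X}_{\mathrm{Input}})\,\delta\mathtt{X}_{\mathrm{Input}}=-\nabla f(\mathtt{X}_{\mathrm{Input}})$$ if and only if it is the input block of $\delta \mathtt{X}_V$ for some solution $(\delta\mathtt{X}_V,\lambda^+)$ of the KKT system $$\begin{bmatrix}\partial_V^2\mathcal{L} & (\partial_V\mathbf{h})^{\mathtt{T}}\\ \partial_V\mathbf{h} & 0\end{bmatrix}\begin{bmatrix}\delta\mathtt{X}_V\\ \lambda^+\end{bmatrix}=\begin{bmatrix}-\partial_V \hat f\\ -\mathbf{h}\end{bmatrix},$$ where $\partial_V^2\mathcal{L}$, $\partial_V\mathbf{h}$, $\partial_V\hat f$, $\mathbf{h}$ are evaluated at $(\mathtt{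X}_V,\lambda)$.
   Context: $\mathcal{G}$ is a finite directed acyclic graph with vertex set $V=V[\mathcal{G}]$ and edge set $E[\mathcal{G}]$; $\mathrm{pa}(v)=\{u:(u,v)\in E[\mathcal{G}]\}$ (parents) and $\mathrm{ch}(v)=\{u:(v,u)\in E[\mathcal{G}]\}$ (children). Each vertex $v$ carries a state $\mathtt{X}_v\in U_v$, with $U_v\subset\mathbb{R}^{n_v}$ open; for $A\subset V$, $\mathtt{X}_A$ is the labelled concatenation of the states of vertices in $A$. The input vertices are $\mathrm{Input}=\{v:\mathrm{pa}(v)=\emptyset\}$; all others are non-input. For each non-input $v$ there is a function $\Phi_v:\prod_{z\in\mathrm{pa}(v)}U_z\to U_v$, and for each $v\in V$ a local objective $l_v:\prod_{z\in\{v\}\cup\mathrm{pa}(v)}U_z\to\mathbb{R}$. Unconstrained problem: minimize over $\mathtt{X}_{\mathrm{Input}}$ the function $f(\mathtt{X}_{\mathrm{Input}})=\sum_{v\in V}l_v(\mathtt{X}_{\{v\}\cup\mathrm{pa}(v)})$, where the non-input states are determined recursively from the inputs by the assignments $\mathtt{X}_v\leftarrow\Phi_v(\mathtt{X}_{\mathrm{pa}(v)})$. $\nabla f$, $\nabla^2 f$ denote the gradient and Hessian of this function of the inputs. Constrained problem: minimize over all $\mathtt{X}_V$ the function $\hat f(\mathtt{X}_V)=\sum_{v\in V}l_v(\mathtt{X}_{\{v\}\cup\mathrm{pa}(v)})$, with all states treated as independent variables, subject to $\mathbf{h}_v(\mathtt{X}_{\{v\}\cup\mathrm{pa}(v)})=\Phi_v(\mathtt{X}_{\mathrm{pa}(v)})-\mathtt{X}_v=0$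 for all non-input $v$. $\mathbf{h}$ is the concatenation of the $\mathbf{h}_v$. The Lagrangian is $\mathcal{L}(\mathtt{X}_V,\lambda)=\hat f(\mathtt{X}_V)+\sum_{v\ \text{non-input}}\lambda_v^{\mathtt{T}}\mathbf{h}_v$, with $\lambda_v\in\mathbb{R}^{n_v}$. $\partial_V$ and $\partial_V^2$ denote first and second derivatives with respect to all of $\mathtt{X}_V$ as independent variables. An iteration of SQP at $(\mathtt{X}_V,\lambda)$ means solving the displayed KKT system, where $\lambda^+=\lambda+\delta\lambda$, for the search direction. The total derivatives $\partial_v f\in\mathbb{R}^{n_v}$ (reverse-mode automatic differentiation) are defined for all $v\in V$, recursively backward over the DAG, by $$\partial_v f=\sum_{s\in\{v\}\cup\mathrm{ch}(v)}\partial_v l_s+\sum_{d\in\mathrm{ch}(v)}\left(\frac{\partial\Phi_d(\mathtt{X}_{\mathrm{pa}(d)})}{\partial\mathtt{X}_v}\right)^{\mathtt{T}}\partial_d f,$$ where $\partial_v l_s$ is the partial gradient of $l_s$ with respect to its argument $\mathtt{X}_v$. *)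

theory Defs
  imports "HOL-Analysis.Analysis" "HOL-Library.FuncSet"
begin

definition gradient :: "('a::real_inner \<Rightarrow> real) \<Rightarrow> 'a \<Rightarrow> 'a"
  where "gradient f x = (THE D. GDERIV f x :> D)"

definition hessian :: "(real ^ 'n \<Rightarrow> real) \<Rightarrow> real ^ 'n \<Rightarrow> real ^ 'n ^ 'n"
  where "hessian f x = jacobian (gradient f) (at x)"

definition C2_on :: "'a::real_normed_vector set \<Rightarrow> ('a \<Rightarrow> 'b::real_normed_vector) \<Rightarrow> bool"
  where "C2_on S f \<longleftrightarrow>
    (\<exists>(f' :: 'a \<Rightarrow> 'a \<Rightarrow>\<^sub>L 'b) (f'' :: 'a \<Rightarrow> 'a \<Rightarrow>\<^sub>L ('a \<Rightarrow>\<^sub>L 'b)).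
       (\<forall>x\<in>S. (f has_derivative blinfun_apply (f' x)) (at x)) \<and>
       (\<forall>x\<in>S. (f' has_derivative blinfun_apply (f'' x)) (at x)) \<and>
       continuous_on S f'')"

text \<open>
  The scalar coordinates of all states together are indexed by the finite type \<open>'n\<close>, and
  \<open>owner\<close> says which vertex a coordinate belongs to; thus the state of \<open>v\<close> has dimension
  \<open>n\<^sub>v = card {i. owner G i = v}\<close>, which may differ from vertex to vertex.  Coordinates owned by
  no vertex of the graph are unused padding.

  For a set \<open>A\<close> of vertices, the labelled product of the state spaces of the vertices \<open>v \<in> A\<close> is
  represented by the subspace \<open>vec_space G A\<close> of vectors that vanish on all coordinates not owned
  by \<open>A\<close>.  In this representation the labelled concatenation of blocks belonging to different
  vertices is their sum, and the subvector \<open>X\<^sub>A\<close> of \<open>X\<close> is \<open>block G A X\<close>.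
\<close>

record ('v, 'n) comp_structure =
  verts  :: "'v set"
  arcs   :: "('v \<times> 'v) set"
  owner  :: "'n \<Rightarrow> 'v"
  region :: "'v \<Rightarrow> (real ^ ('n::finite)) set"
  Phi    :: "'v \<Rightarrow> real ^ 'n \<Rightarrow> real ^ 'n"
  loss   :: "'v \<Rightarrow> real ^ 'n \<Rightarrow> real"

definition dag :: "('v, 'n::finite) comp_structure \<Rightarrow> bool"
  where "dag G \<longleftrightarrow> finite (verts G) \<and> arcs G \<subseteq> verts G \<times> verts G \<and> acyclic (arcs G)"

definition pa :: "('v, 'n::finite) comp_structure \<Rightarrow> 'v \<Rightarrow> 'v set"
  where "pa G v = {u. (u, v) \<in> arcs G}"

definition ch :: "('v, 'n::finite) comp_structure \<Rightarrow> 'v \<Rightarrow> 'v set"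
  where "ch G v = {u. (v, u) \<in> arcs G}"

definition inputs :: "('v, 'n::finite) comp_structure \<Rightarrow> 'v set"
  where "inputs G = {v \<in> verts G. pa G v = {}}"

definition noninputs :: "('v, 'n::finite) comp_structure \<Rightarrow> 'v set"
  where "noninputs G = verts G - inputs G"

definition vec_space :: "('v, 'n::finite) comp_structure \<Rightarrow> 'v set \<Rightarrow> (real ^ 'n) set"
  where "vec_space G A = {x. \<forall>i. owner G i \<notin> A \<longrightarrow> x $ i = 0}"

definition block :: "('v, 'n::finite) comp_structure \<Rightarrow> 'v set \<Rightarrow> real ^ 'n \<Rightarrow> real ^ 'n"
  where "block G A x = (\<chi> i. if owner G i \<in> A then x $ i else 0)"

text \<open>The product of the sets \<open>U\<^sub>v\<close> (here \<open>region G v\<close>) over \<open>v \<in> A\<close>.\<close>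

definition states :: "('v, 'n::finite) comp_structure \<Rightarrow> 'v set \<Rightarrow> (real ^ 'n) set"
  where "states G A = {x \<in> vec_space G A. \<forall>v\<in>A. block G {v} x \<in> region G v}"

abbreviation fam :: "('v, 'n::finite) comp_structure \<Rightarrow> 'v \<Rightarrow> 'v set"
  where "fam G v \<equiv> insert v (pa G v)"

text \<open>
  The functions \<open>\<Phi>\<^sub>v\<close> and \<open>l\<^sub>v\<close> regarded as functions of all states.  They are constant in the
  coordinates that are not among their arguments, so that their derivatives in the remaining
  coordinates are those of \<open>\<Phi>\<^sub>v\<close> and \<open>l\<^sub>v\<close>, and being twice continuously differentiable on the
  open cylinder over the domain is the same as being so on the domain.
\<close>

definition Phi_of :: "('v, 'n::finite) comp_structure \<Rightarrow> 'v \<Rightarrow> real ^ 'n \<Rightarrow> real ^ 'n"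
  where "Phi_of G v X = Phi G v (block G (pa G v) X)"

definition loss_of :: "('v, 'n::finite) comp_structure \<Rightarrow> 'v \<Rightarrow> real ^ 'n \<Rightarrow> real"
  where "loss_of G v X = loss G v (block G (fam G v) X)"

definition comp_structure :: "('v, 'n::finite) comp_structure \<Rightarrow> bool"
  where "comp_structure G \<longleftrightarrow>
    dag G \<and>
    (\<forall>v\<in>verts G. openin (top_of_set (vec_space G {v})) (region G v)) \<and>
    (\<forall>v\<in>noninputs G. Phi G v \<in> states G (pa G v) \<rightarrow> region G v)"

definition C2_structure :: "('v, 'n::finite) comp_structure \<Rightarrow> bool"
  where "C2_structure G \<longleftrightarrow>
    (\<forall>v\<in>noninputs G. C2_on {X. block G (pa G v) X \<in> states G (pa G v)} (Phi_of G v)) \<and>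
    (\<forall>v\<in>verts G. C2_on {X. block G (fam G v) X \<in> states G (fam G v)} (loss_of G v))"

lemma finite_arcs: "dag G \<Longrightarrow> finite (arcs G)"
  by (auto simp: dag_def intro: finite_subset[OF _ finite_cartesian_product])

lemma card_ancestors_less:
  assumes "dag G" "(u, v) \<in> arcs G"
  shows "card {w. (w, u) \<in> (arcs G)\<^sup>+} < card {w. (w, v) \<in> (arcs G)\<^sup>+}"
proof (rule psubset_card_mono)
  have "{w. (w, v) \<in> (arcs G)\<^sup>+} \<subseteq> fst ` (arcs G)\<^sup>+"
    by force
  then show "finite {w. (w, v) \<in> (arcs G)\<^sup>+}"
    using finite_arcs[OF assms(1)] by (meson finite_imageI finite_subset finite_trancl)
  have "(u, u) \<notin> (arcs G)\<^sup>+"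
    using assms(1) by (auto simp: dag_def acyclic_def)
  then show "{w. (w, u) \<in> (arcs G)\<^sup>+} \<subset> {w. (w, v) \<in> (arcs G)\<^sup>+}"
    using assms(2) by (auto intro: trancl_into_trancl)
qed

lemma card_descendants_less:
  assumes "dag G" "(v, u) \<in> arcs G"
  shows "card {w. (u, w) \<in> (arcs G)\<^sup>+} < card {w. (v, w) \<in> (arcs G)\<^sup>+}"
proof (rule psubset_card_mono)
  have "{w. (v, w) \<in> (arcs G)\<^sup>+} \<subseteq> snd ` (arcs G)\<^sup>+"
    by force
  then show "finite {w. (v, w) \<in> (arcs G)\<^sup>+}"
    using finite_arcs[OF assms(1)] by (meson finite_imageI finite_subset finite_trancl)
  have "(u, u) \<notin> (arcs G)\<^sup>+"
    using assms(1) by (auto simp: dag_def acyclic_def)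
  then show "{w. (u, w) \<in> (arcs G)\<^sup>+} \<subset> {w. (v, w) \<in> (arcs G)\<^sup>+}"
    using assms(2) by (auto intro: trancl_into_trancl2)
qed

text \<open>
  The state of \<open>v\<close> determined by the inputs \<open>x\<close>; the argument of \<open>\<Phi>\<^sub>v\<close> is the concatenation of
  the states of the parents.  The test \<open>dag G\<close> only serves to make the recursion terminate.
\<close>

function state :: "('v, 'n::finite) comp_structure \<Rightarrow> real ^ 'n \<Rightarrow> 'v \<Rightarrow> real ^ 'n"
  where "state G x v =
    (if dag G then
       if pa G v = {} then block G {v} x else Phi G v (\<Sum>z\<in>pa G v. state G x z)
     else 0)"
  by pat_completeness auto
termination
  by (relation "Wellfounded.measure (\<lambda>(G, x, v). card {w. (w, v) \<in> (arcs G)\<^sup>+})")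
    (auto simp: pa_def intro: card_ancestors_less)

declare state.simps [simp del]

definition all_states :: "('v, 'n::finite) comp_structure \<Rightarrow> real ^ 'n \<Rightarrow> real ^ 'n"
  where "all_states G x = (\<Sum>v\<in>verts G. state G x v)"

text \<open>
  The objective depends only on the input coordinates of its argument, so its gradient and
  Hessian vanish in all other coordinates.
\<close>

definition objective :: "('v, 'n::finite) comp_structure \<Rightarrow> real ^ 'n \<Rightarrow> real"
  where "objective G x = (\<Sum>v\<in>verts G. loss_of G v (all_states G x))"

definition newton_equation ::
    "('v, 'n::finite) comp_structure \<Rightarrow> real ^ 'n \<Rightarrow> real ^ 'n \<Rightarrow> bool"
  where "newton_equation G x dx \<longleftrightarrow>
    hessian (objective G) x *v dx = - gradient (objective G) x"

definition objective_hat :: "('v, 'n::finite) comp_structure \<Rightarrow> real ^ 'n \<Rightarrow> real"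
  where "objective_hat G X = (\<Sum>v\<in>verts G. loss_of G v X)"

definition constraint :: "('v, 'n::finite) comp_structure \<Rightarrow> 'v \<Rightarrow> real ^ 'n \<Rightarrow> real ^ 'n"
  where "constraint G v X = Phi_of G v X - block G {v} X"

definition constraints :: "('v, 'n::finite) comp_structure \<Rightarrow> real ^ 'n \<Rightarrow> real ^ 'n"
  where "constraints G X = (\<Sum>v\<in>noninputs G. constraint G v X)"

definition feasible :: "('v, 'n::finite) comp_structure \<Rightarrow> real ^ 'n \<Rightarrow> bool"
  where "feasible G X \<longleftrightarrow>
    X \<in> states G (verts G) \<and> (\<forall>v\<in>noninputs G. block G {v} X = Phi_of G v X)"

definition lagrangian ::
    "('v, 'n::finite) comp_structure \<Rightarrow> real ^ 'n \<Rightarrow> real ^ 'n \<Rightarrow> real"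
  where "lagrangian G X lam =
    objective_hat G X + (\<Sum>v\<in>noninputs G. block G {v} lam \<bullet> constraint G v X)"

text \<open>\<open>lamp\<close> is the updated multiplier \<open>\<lambda>\<^sup>+\<close>.\<close>

definition kkt_solution ::
    "('v, 'n::finite) comp_structure \<Rightarrow> real ^ 'n \<Rightarrow> real ^ 'n \<Rightarrow> real ^ 'n \<Rightarrow> real ^ 'n \<Rightarrow> bool"
  where "kkt_solution G X lam dX lamp \<longleftrightarrow>
    dX \<in> vec_space G (verts G) \<and> lamp \<in> vec_space G (noninputs G) \<and>
    hessian (\<lambda>Y. lagrangian G Y lam) X *v dX
      + transpose (jacobian (constraints G) (at X)) *v lamp = - gradient (objective_hat G) X \<and>
    jacobian (constraints G) (at X) *v dX = - constraints G X"

definition partial_grad_loss ::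
    "('v, 'n::finite) comp_structure \<Rightarrow> 'v \<Rightarrow> 'v \<Rightarrow> real ^ 'n \<Rightarrow> real ^ 'n"
  where "partial_grad_loss G v s X = block G {v} (gradient (loss_of G s) X)"

text \<open>The columns of the Jacobian of \<open>\<Phi>\<^sub>d\<close> that belong to the argument \<open>X\<^sub>v\<close>; the others are zero.\<close>

definition partial_jac_Phi ::
    "('v, 'n::finite) comp_structure \<Rightarrow> 'v \<Rightarrow> 'v \<Rightarrow> real ^ 'n \<Rightarrow> real ^ 'n ^ 'n"
  where "partial_jac_Phi G v d X =
    (\<chi> i j. if owner G j = v then jacobian (Phi_of G d) (at X) $ i $ j else 0)"

text \<open>As for \<open>state\<close>, the test \<open>dag G\<close> only serves to make the recursion terminate.\<close>

function total_deriv :: "('v, 'n::finite) comp_structure \<Rightarrow> real ^ 'n \<Rightarrow> 'v \<Rightarrow> real ^ 'n"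
  where "total_deriv G X v =
    (if dag G then
       (\<Sum>s\<in>insert v (ch G v). partial_grad_loss G v s X)
       + (\<Sum>d\<in>ch G v. transpose (partial_jac_Phi G v d X) *v total_deriv G X d)
     else 0)"
  by pat_completeness auto
termination
  by (relation "Wellfounded.measure (\<lambda>(G, X, v). card {w. (v, w) \<in> (arcs G)\<^sup>+})")
    (auto simp: ch_def intro: card_descendants_less)

declare total_deriv.simps [simp del]

end

theory Submission
  imports Defs
begin

text \<open>
  Let \<open>S\<close> map inputs to all states.  Since \<open>S\<close> satisfies the constraints, \<open>f x = L (S x) \<lambda>\<close> for
  every fixed \<open>\<lambda>\<close>.  Reverse-mode differentiation is exactly stationarity of \<open>L\<close> in the non-input
  coordinates, and \<open>S''\<close> has only non-input components, so the second-order term of the chain rule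
  vanishes and \<open>\<nabla>\<^sup>2f = S'\<^sup>T (\<partial>\<^sup>2L) S'\<close>, \<open>\<nabla>f = S'\<^sup>T \<partial>f\<^sub>h\<^sub>a\<^sub>t\<close>.  The range of \<open>S'\<close> is the kernel of the
  constraint Jacobian \<open>H\<close>; hence the Newton equation says that the residual
  \<open>- \<partial>f\<^sub>h\<^sub>a\<^sub>t - (\<partial>\<^sup>2L) \<delta>X\<close> with \<open>\<delta>X = S' \<delta>x\<close> is orthogonal to \<open>ker H\<close>, that is, equal to
  \<open>H\<^sup>T \<lambda>\<^sup>+\<close> for some \<open>\<lambda>\<^sup>+\<close>.
\<close>

section \<open>Twice differentiable maps\<close>

text \<open>First derivatives are bundled as bounded linear maps, so that \<open>f'\<close> is
  itself a map into a normed space and can be differentiated again without coordinates.\<close>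

definition diff2_on :: "'a::real_normed_vector set \<Rightarrow> ('a \<Rightarrow> 'b::real_normed_vector) \<Rightarrow> bool"
  where "diff2_on S f \<longleftrightarrow>
    (\<exists>(f' :: 'a \<Rightarrow> 'a \<Rightarrow>\<^sub>L 'b) (f'' :: 'a \<Rightarrow> 'a \<Rightarrow>\<^sub>L ('a \<Rightarrow>\<^sub>L 'b)).
       (\<forall>x\<in>S. (f has_derivative blinfun_apply (f' x)) (at x)) \<and>
       (\<forall>x\<in>S. (f' has_derivative blinfun_apply (f'' x)) (at x)))"

text \<open>The second derivative may be supplied as an ordinary function:
  \<open>has_derivative\<close> already carries its boundedness, so it can be bundled
  afterwards.\<close>

lemma diff2_onI:
  fixes f' :: "'a::real_normed_vector \<Rightarrow> 'a \<Rightarrow>\<^sub>L 'b::real_normed_vector"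
    and f'' :: "'a \<Rightarrow> 'a \<Rightarrow> ('a \<Rightarrow>\<^sub>L 'b)"
  assumes "\<And>x. x \<in> S \<Longrightarrow> (f has_derivative blinfun_apply (f' x)) (at x)"
    "\<And>x. x \<in> S \<Longrightarrow> (f' has_derivative f'' x) (at x)"
  shows "diff2_on S f"
  unfolding diff2_on_def
proof (intro exI conjI ballI)
  fix x assume "x \<in> S"
  then show "(f has_derivative blinfun_apply (f' x)) (at x)"
    by (rule assms)
  have "bounded_linear (f'' x)"
    using assms(2)[OF \<open>x \<in> S\<close>] by (rule has_derivative_bounded_linear)
  then show "(f' has_derivative blinfun_apply (Blinfun (f'' x))) (at x)"
    using assms(2)[OF \<open>x \<in> S\<close>] by (simp add: bounded_linear_Blinfun_apply)
qed

lemma diff2_on_imp_has_derivative: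
  "diff2_on S f \<Longrightarrow> x \<in> S \<Longrightarrow> \<exists>D. (f has_derivative D) (at x)"
  unfolding diff2_on_def by blast

lemma C2_on_imp_diff2_on: "C2_on S f \<Longrightarrow> diff2_on S f"
  unfolding C2_on_def diff2_on_def by blast

lemma diff2_on_subset: "diff2_on T f \<Longrightarrow> S \<subseteq> T \<Longrightarrow> diff2_on S f"
  unfolding diff2_on_def by blast

lemma diff2_on_linear:
  assumes "bounded_linear f"
  shows "diff2_on S f"
proof (rule diff2_onI)
  fix x
  show "(f has_derivative blinfun_apply (Blinfun f)) (at x)"
    using assms by (simp add: bounded_linear_Blinfun_apply bounded_linear_imp_has_derivative)
  show "((\<lambda>x. Blinfun f) has_derivative (\<lambda>h. 0)) (at x)"
    by simp
qed

lemma diff2_on_zero: "diff2_on S (\<lambda>x. 0)"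
  by (rule diff2_on_linear) simp

lemma diff2_on_add:
  assumes "diff2_on S f" "diff2_on S g"
  shows "diff2_on S (\<lambda>x. f x + g x)"
proof -
  obtain f' f'' where f: "\<And>x. x \<in> S \<Longrightarrow> (f has_derivative blinfun_apply (f' x)) (at x)"
    "\<And>x. x \<in> S \<Longrightarrow> (f' has_derivative blinfun_apply (f'' x)) (at x)"
    using assms(1) unfolding diff2_on_def by blast
  obtain g' g'' where g: "\<And>x. x \<in> S \<Longrightarrow> (g has_derivative blinfun_apply (g' x)) (at x)"
    "\<And>x. x \<in> S \<Longrightarrow> (g' has_derivative blinfun_apply (g'' x)) (at x)"
    using assms(2) unfolding diff2_on_def by blast
  show ?thesis
  proof (rule diff2_onI)
    fix x assume x: "x \<in> S"
    show "((\<lambda>x. f x + g x) has_derivative blinfun_apply (f' x + g' x)) (at x)"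
      using has_derivative_add[OF f(1)[OF x] g(1)[OF x]] by (simp add: plus_blinfun.rep_eq)
    show "((\<lambda>x. f' x + g' x) has_derivative (\<lambda>h. f'' x h + g'' x h)) (at x)"
      by (rule has_derivative_add[OF f(2)[OF x] g(2)[OF x]])
  qed
qed

lemma diff2_on_sum:
  "(\<And>i. i \<in> I \<Longrightarrow> diff2_on S (f i)) \<Longrightarrow> diff2_on S (\<lambda>x. \<Sum>i\<in>I. f i x)"
  by (induction I rule: infinite_finite_induct) (auto intro: diff2_on_zero diff2_on_add)

lemma diff2_on_cong:
  fixes f g :: "'a::real_normed_vector \<Rightarrow> 'b::real_normed_vector"
  assumes "open S" "\<And>x. x \<in> S \<Longrightarrow> f x = g x" "diff2_on S f"
  shows "diff2_on S g"
proof -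
  obtain f' f'' where f: "\<And>x. x \<in> S \<Longrightarrow> (f has_derivative blinfun_apply (f' x)) (at x)"
    "\<And>x. x \<in> S \<Longrightarrow> (f' has_derivative blinfun_apply (f'' x)) (at x)"
    using assms(3) unfolding diff2_on_def by blast
  show ?thesis
    by (rule diff2_onI) (use f assms(1,2) has_derivative_transform_within_open in blast)+
qed

text \<open>Composition of bounded linear maps is bilinear, so the product rule applies to the first
  derivative of \<open>g\<close> after \<open>f\<close>. The two summands are the usual ones:
  \<open>g'\<close> applied to the second derivative of \<open>f\<close>, and the second derivative
  of \<open>g\<close> with \<open>f'\<close> in both slots.\<close>

lemma has_derivative_blinfun_chain:
  fixes f' :: "'a::real_normed_vector \<Rightarrow> 'a \<Rightarrow>\<^sub>L 'b::real_normed_vector"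
    and g' :: "'b \<Rightarrow> 'b \<Rightarrow>\<^sub>L 'c::real_normed_vector"
  assumes "(f has_derivative blinfun_apply (f' x)) (at x)"
    "(f' has_derivative f2) (at x)" "(g' has_derivative g2) (at (f x))"
  shows "((\<lambda>y. g' (f y) o\<^sub>L f' y) has_derivative
    (\<lambda>h. (g' (f x) o\<^sub>L f2 h) + (g2 (f' x h) o\<^sub>L f' x))) (at x)"
  using bounded_bilinear.FDERIV[OF bounded_bilinear_blinfun_compose
      has_derivative_compose[OF assms(1,3)] assms(2)] .

lemma diff2_on_compose:
  fixes f :: "'a::real_normed_vector \<Rightarrow> 'b::real_normed_vector"
    and g :: "'b \<Rightarrow> 'c::real_normed_vector"
  assumes "diff2_on S f" "diff2_on T g" "f \<in> S \<rightarrow> T"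
  shows "diff2_on S (\<lambda>x. g (f x))"
proof -
  obtain f' f'' where f: "\<And>x. x \<in> S \<Longrightarrow> (f has_derivative blinfun_apply (f' x)) (at x)"
    "\<And>x. x \<in> S \<Longrightarrow> (f' has_derivative blinfun_apply (f'' x)) (at x)"
    using assms(1) unfolding diff2_on_def by blast
  obtain g' g'' where g: "\<And>x. x \<in> T \<Longrightarrow> (g has_derivative blinfun_apply (g' x)) (at x)"
    "\<And>x. x \<in> T \<Longrightarrow> (g' has_derivative blinfun_apply (g'' x)) (at x)"
    using assms(2) unfolding diff2_on_def by blast
  show ?thesis
  proof (rule diff2_onI)
    fix x assume x: "x \<in> S"
    then have fx: "f x \<in> T" using assms(3) by blast
    show "((\<lambda>x. g (f x)) has_derivative blinfun_apply (g' (f x) o\<^sub>L f' x)) (at x)"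
      using has_derivative_compose[OF f(1)[OF x] g(1)[OF fx]] by (simp add: blinfun_compose.rep_eq o_def)
    show "((\<lambda>y. g' (f y) o\<^sub>L f' y) has_derivative
        (\<lambda>h. (g' (f x) o\<^sub>L f'' x h) + (g'' (f x) (f' x h) o\<^sub>L f' x))) (at x)"
      by (rule has_derivative_blinfun_chain[OF f(1)[OF x] f(2)[OF x] g(2)[OF fx]])
  qed
qed

section \<open>Gradients, Jacobians and Hessians as linear and bilinear forms\<close>

lemma gradient_eq:
  assumes "(f has_derivative (\<lambda>h. h \<bullet> D)) (at x)"
  shows "gradient f x = D"
  unfolding gradient_def
proof (rule the_equality)
  show "GDERIV f x :> D"
    using assms by (simp add: gderiv_def)
  fix E assume "GDERIV f x :> E"
  then have "(f has_derivative (\<lambda>h. h \<bullet> E)) (at x)"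
    by (simp add: gderiv_def)
  then have "(\<lambda>h. h \<bullet> E) = (\<lambda>h. h \<bullet> D)"
    using assms by (rule has_derivative_unique)
  then show "E = D"
    by (metis vector_eq_ldot)
qed

text \<open>The Riesz representative in coordinates. It is linear in \<open>D\<close>, which makes
  it possible to differentiate a gradient by differentiating the underlying functional.\<close>

lemma linear_functional_inner:
  fixes D :: "'a::euclidean_space \<Rightarrow> real"
  assumes "linear D"
  shows "w \<bullet> (\<Sum>b\<in>Basis. D b *\<^sub>R b) = D w"
proof -
  have "D w = D (\<Sum>b\<in>Basis. (w \<bullet> b) *\<^sub>R b)"
    by (simp add: euclidean_representation)
  also have "\<dots> = (\<Sum>b\<in>Basis. (w \<bullet> b) * D b)"
    using assms by (simp add: linear_sum linear_scale)
  finally show ?thesis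
    by (simp add: inner_sum_right mult.commute)
qed

lemma gradient_eq_sum:
  fixes f :: "'a::euclidean_space \<Rightarrow> real"
  assumes "(f has_derivative D) (at x)"
  shows "gradient f x = (\<Sum>b\<in>Basis. D b *\<^sub>R b)"
  by (rule gradient_eq)
    (use assms in \<open>simp add: linear_functional_inner[OF has_derivative_linear[OF assms]]\<close>)

lemma inner_gradient:
  fixes f :: "'a::euclidean_space \<Rightarrow> real"
  assumes "(f has_derivative D) (at x)"
  shows "h \<bullet> gradient f x = D h"
  unfolding gradient_eq_sum[OF assms]
  by (rule linear_functional_inner[OF has_derivative_linear[OF assms]])

lemma jacobian_mult:
  fixes f :: "real ^ 'n \<Rightarrow> real ^ 'm"
  assumes "(f has_derivative D) (at x)"
  shows "jacobian f (at x) *v h = D h"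
  unfolding jacobian_def frechet_derivative_at[OF assms, symmetric]
  using matrix_vector_mul(2)[OF has_derivative_linear[OF assms]] by (rule fun_cong)

text \<open>Near \<open>x\<close> the gradient is the Riesz representative of \<open>f' y\<close>,
  hence a bounded linear image of \<open>f'\<close>; openness of \<open>S\<close> lets this identity
  be differentiated at \<open>x\<close>. The first argument of \<open>f''\<close> is the direction
  of differentiation, so no symmetry enters.\<close>

lemma inner_hessian:
  fixes f :: "real ^ 'n \<Rightarrow> real" and f' :: "real ^ 'n \<Rightarrow> (real ^ 'n) \<Rightarrow>\<^sub>L real"
  assumes "open S" "x \<in> S"
    "\<And>y. y \<in> S \<Longrightarrow> (f has_derivative blinfun_apply (f' y)) (at y)"
    "(f' has_derivative f'') (at x)"
  shows "w \<bullet> (hessian f x *v u) = f'' u w"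
proof -
  have "((\<lambda>y. \<Sum>b\<in>Basis. f' y b *\<^sub>R b) has_derivative (\<lambda>h. \<Sum>b\<in>Basis. f'' h b *\<^sub>R b)) (at x)"
    by (intro has_derivative_sum has_derivative_scaleR_left
        bounded_linear.has_derivative[OF blinfun.bounded_linear_left] assms(4))
  then have "(gradient f has_derivative (\<lambda>h. \<Sum>b\<in>Basis. f'' h b *\<^sub>R b)) (at x)"
    by (rule has_derivative_transform_within_open[OF _ assms(1,2)])
      (simp add: gradient_eq_sum[OF assms(3)])
  then have "hessian f x *v u = (\<Sum>b\<in>Basis. f'' u b *\<^sub>R b)"
    unfolding hessian_def by (rule jacobian_mult)
  then show ?thesis
    by (simp only: linear_functional_inner[OF bounded_linear.linear[OF blinfun.bounded_linear_right]])
qed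

text \<open>By the chain rule \<open>D e\<close> is the derivative of a constant function of
  \<open>t\<close>. This serves for directions that a function does not read.\<close>

lemma derivative_along_constant_line:
  assumes "(f has_derivative D) (at x)" "\<And>t. f (x + t *\<^sub>R e) = f x"
  shows "D e = 0"
proof -
  have "((\<lambda>t::real. x + t *\<^sub>R e) has_derivative (\<lambda>t. t *\<^sub>R e)) (at 0)"
    by (auto intro!: derivative_eq_intros)
  moreover have "(f has_derivative D) (at (x + 0 *\<^sub>R e))"
    using assms(1) by simp
  ultimately have "((\<lambda>t. f (x + t *\<^sub>R e)) has_derivative (\<lambda>t. D (t *\<^sub>R e))) (at 0)"
    by (rule has_derivative_compose)
  then have "((\<lambda>t::real. f x) has_derivative (\<lambda>t. D (t *\<^sub>R e))) (at 0)"
    using assms(2) by simp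
  then have "(\<lambda>t. D (t *\<^sub>R e)) = (\<lambda>t. 0)"
    by (rule has_derivative_unique) simp
  then show ?thesis
    by (metis scaleR_one)
qed

section \<open>The range of a transpose\<close>

lemma inner_transpose_mult:
  fixes A :: "real ^ 'n ^ 'm"
  shows "k \<bullet> (transpose A *v l) = l \<bullet> (A *v k)"
  by (metis dot_lmul_matrix inner_commute transpose_matrix_vector)

text \<open>The Fredholm alternative, used to produce the new multiplier. A vector \<open>k\<close>
  orthogonal to the range of the transpose satisfies \<open>(A *v k) \<bullet> (A *v k) = 0\<close>
  and so lies in the kernel; the double orthogonal complement of the range is the range
  itself.\<close>

lemma range_transpose_eq_kernel_orthogonal:
  fixes A :: "real ^ 'n ^ 'm"
  assumes "\<And>k. A *v k = 0 \<Longrightarrow> k \<bullet> r = 0"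
  shows "\<exists>l. transpose A *v l = r"
proof -
  have "(range (\<lambda>l. transpose A *v l))\<^sup>\<bottom> \<subseteq> {k. A *v k = 0}"
  proof
    fix k assume "k \<in> (range (\<lambda>l. transpose A *v l))\<^sup>\<bottom>"
    then have "(transpose A *v (A *v k)) \<bullet> k = 0"
      by (auto simp: orthogonal_comp_def orthogonal_def)
    then have "(A *v k) \<bullet> (A *v k) = 0"
      by (simp only: inner_transpose_mult inner_commute[of _ k])
    then show "k \<in> {k. A *v k = 0}" by simp
  qed
  then have "r \<in> (range (\<lambda>l. transpose A *v l))\<^sup>\<bottom>\<^sup>\<bottom>"
    using assms by (auto simp: orthogonal_comp_def orthogonal_def inner_commute)
  moreover have "subspace (range (\<lambda>l. transpose A *v l))"
    by (intro linear_subspace_image subspace_UNIV matrix_vector_mul_linear)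
  ultimately show ?thesis
    by (auto simp: orthogonal_comp_self)
qed

section \<open>Blocks\<close>

lemma block_nth [simp]: "block G A x $ i = (if owner G i \<in> A then x $ i else 0)"
  by (simp add: block_def)

lemma linear_block: "linear (block G A)"
  by (rule linearI) (auto simp: vec_eq_iff)

lemma bounded_linear_block: "bounded_linear (block G A)"
  using linear_block by (simp add: linear_conv_bounded_linear)

lemmas block_add = linear_add[OF linear_block]
  and block_diff = linear_diff[OF linear_block]
  and block_scaleR = linear_scale[OF linear_block]
  and block_zero = linear_0[OF linear_block]
  and block_sum = linear_sum[OF linear_block]

lemma block_block: "block G A (block G B x) = block G (A \<inter> B) x"
  by (simp add: vec_eq_iff)

lemma block_empty: "block G {} x = 0"
  by (simp add: vec_eq_iff)

lemma inner_block: "block G A x \<bullet> y = x \<bullet> block G A y"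
  by (auto simp: inner_vec_def intro: sum.cong)

lemma block_in_vec_space: "block G A x \<in> vec_space G A"
  by (simp add: vec_space_def)

lemma vec_space_iff_block: "x \<in> vec_space G A \<longleftrightarrow> block G A x = x"
  by (auto simp: vec_space_def vec_eq_iff)

lemma vec_space_mono: "A \<subseteq> B \<Longrightarrow> vec_space G A \<subseteq> vec_space G B"
  by (auto simp: vec_space_def)

lemma block_vec_space_disjoint: "x \<in> vec_space G B \<Longrightarrow> A \<inter> B = {} \<Longrightarrow> block G A x = 0"
  by (metis vec_space_iff_block block_block block_empty)

lemma block_vec_space_subset: "x \<in> vec_space G B \<Longrightarrow> B \<subseteq> A \<Longrightarrow> block G A x = x"
  by (metis vec_space_iff_block vec_space_mono subsetD)

lemma block_zero_subset: "block G B x = 0 \<Longrightarrow> A \<subseteq> B \<Longrightarrow> block G A x = 0"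
  by (metis block_block block_zero inf.absorb1)

lemma sum_block: "finite A \<Longrightarrow> (\<Sum>v\<in>A. block G {v} x) = block G A x"
  by (simp add: vec_eq_iff if_distrib sum.delta cong: if_cong)

lemma block_sum_family:
  assumes "finite A" "\<And>z. z \<in> A \<Longrightarrow> x z \<in> vec_space G {z}"
  shows "block G B (\<Sum>z\<in>A. x z) = (\<Sum>z\<in>A \<inter> B. x z)"
proof -
  have "block G B (\<Sum>z\<in>A. x z) = (\<Sum>z\<in>A. block G B (x z))"
    by (simp add: block_sum)
  also have "\<dots> = (\<Sum>z\<in>A. if z \<in> B then x z else 0)"
    by (rule sum.cong)
      (use assms(2) in \<open>auto intro: block_vec_space_disjoint block_vec_space_subset\<close>)
  finally show ?thesis
    using assms(1) by (simp add: sum.inter_restrict)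
qed

text \<open>Induction from parents to children, well-founded because the number of ancestors
  strictly grows along an arc.\<close>

lemma dag_induct:
  fixes G :: "('v, 'n::finite) comp_structure"
  assumes "dag G" "\<And>v. (\<And>u. u \<in> pa G v \<Longrightarrow> P u) \<Longrightarrow> P v"
  shows "P v"
proof (induction "card {w. (w, v) \<in> (arcs G)\<^sup>+}" arbitrary: v rule: less_induct)
  case less
  show ?case
    by (rule assms(2)) (use less card_ancestors_less[OF assms(1)] in \<open>auto simp: pa_def\<close>)
qed

section \<open>The state map and the constraints\<close>

locale c2_comp_structure =
  fixes G :: "('v, 'n::finite) comp_structure"
  assumes comp: "comp_structure G" and C2: "C2_structure G"
begin

text \<open>Only the blocks in \<open>A\<close> are restricted, while all other coordinates, padding
  included, stay free. Unlike \<open>states G A\<close>, which sits inside the subspace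
  \<open>vec_space G A\<close>, this set is open in the full space when \<open>A\<close> consists of
  vertices of the graph, as full derivatives require.\<close>

definition cyl :: "'v set \<Rightarrow> (real ^ 'n) set"
  where "cyl A = {Y. \<forall>v\<in>A. block G {v} Y \<in> region G v}"

lemma dag: "dag G"
  using comp by (simp add: comp_structure_def)

lemma finite_verts [simp]: "finite (verts G)"
  using dag by (simp add: dag_def)

lemma pa_subset: "pa G v \<subseteq> verts G"
  using dag by (auto simp: dag_def pa_def)

lemma ch_subset: "ch G v \<subseteq> noninputs G"
  using dag by (auto simp: dag_def ch_def noninputs_def inputs_def pa_def)

lemma in_pa_iff_in_ch: "v \<in> pa G d \<longleftrightarrow> d \<in> ch G v"
  by (simp add: pa_def ch_def)

lemma inputs_subset: "inputs G \<subseteq> verts G" and noninputs_subset: "noninputs G \<subseteq> verts G"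
  by (auto simp: inputs_def noninputs_def)

lemma finite_noninputs [simp]: "finite (noninputs G)"
  using finite_subset[OF noninputs_subset] by simp

lemma region_subset: "v \<in> verts G \<Longrightarrow> region G v \<subseteq> vec_space G {v}"
  using comp openin_imp_subset by (fastforce simp: comp_structure_def)

lemma cyl_antimono: "A \<subseteq> B \<Longrightarrow> cyl B \<subseteq> cyl A"
  by (auto simp: cyl_def)

text \<open>A region is only relatively open in its block space, but its preimage under the
  continuous projection \<open>block G {v}\<close> is open; the cylinder is a finite intersection of
  such preimages.\<close>

lemma open_cyl:
  assumes "A \<subseteq> verts G"
  shows "open (cyl A)"
proof -
  have "open (block G {v} -` region G v)" if "v \<in> A" for v
  proof -
    have "openin (top_of_set (vec_space G {v})) (region G v)"
      using comp that assms by (auto simp: comp_structure_def)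
    then obtain U where U: "open U" "region G v = vec_space G {v} \<inter> U"
      by (auto simp: openin_open)
    have "block G {v} -` region G v = block G {v} -` U"
      using U(2) block_in_vec_space by auto
    then show ?thesis
      using U(1) open_vimage linear_continuous_on[OF bounded_linear_block] by metis
  qed
  moreover have "cyl A = (\<Inter>v\<in>A. block G {v} -` region G v)"
    by (auto simp: cyl_def)
  ultimately show ?thesis
    using finite_subset[OF assms] by auto
qed

lemma block_in_states: "A \<subseteq> B \<Longrightarrow> Y \<in> cyl B \<Longrightarrow> block G A Y \<in> states G A"
  by (auto simp: states_def cyl_def block_in_vec_space block_block)

lemma Phi_of_in_region: "v \<in> noninputs G \<Longrightarrow> Y \<in> cyl (pa G v) \<Longrightarrow> Phi_of G v Y \<in> region G v"
  using comp block_in_states[OF subset_refl, of Y "pa G v"] unfolding comp_structure_def Phi_of_def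
  by blast

lemma Phi_of_in_vec_space:
  "v \<in> noninputs G \<Longrightarrow> Y \<in> cyl (verts G) \<Longrightarrow> Phi_of G v Y \<in> vec_space G {v}"
  using Phi_of_in_region[of v Y] region_subset[of v] pa_subset[of v] noninputs_subset
  by (auto simp: cyl_def)

section \<open>Smoothness and block structure of the constraints and the Lagrangian\<close>

lemma diff2_Phi_of: "v \<in> noninputs G \<Longrightarrow> diff2_on (cyl (pa G v)) (Phi_of G v)"
  using C2 block_in_states[OF subset_refl] unfolding C2_structure_def
  by (blast intro: diff2_on_subset C2_on_imp_diff2_on)

lemma diff2_loss_of: "v \<in> verts G \<Longrightarrow> diff2_on (cyl (verts G)) (loss_of G v)"
  using C2 block_in_states[of "fam G v" "verts G"] pa_subset[of v] unfolding C2_structure_def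
  by (blast intro: diff2_on_subset C2_on_imp_diff2_on)

lemma diff2_constraint:
  assumes "v \<in> noninputs G"
  shows "diff2_on (cyl (verts G)) (constraint G v)"
proof -
  have "diff2_on (cyl (verts G)) (Phi_of G v)"
    by (rule diff2_on_subset[OF diff2_Phi_of[OF assms] cyl_antimono[OF pa_subset]])
  moreover have "diff2_on (cyl (verts G)) (\<lambda>Y. - block G {v} Y)"
    by (intro diff2_on_linear bounded_linear_minus bounded_linear_block)
  ultimately have "diff2_on (cyl (verts G)) (\<lambda>Y. Phi_of G v Y + - block G {v} Y)"
    by (rule diff2_on_add)
  then show ?thesis
    by (simp add: constraint_def[abs_def])
qed

lemma diff2_objective_hat: "diff2_on (cyl (verts G)) (objective_hat G)"
  unfolding objective_hat_def[abs_def] by (intro diff2_on_sum diff2_loss_of)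

lemma diff2_constraints: "diff2_on (cyl (verts G)) (constraints G)"
  unfolding constraints_def[abs_def] by (intro diff2_on_sum diff2_constraint)

lemma diff2_lagrangian: "diff2_on (cyl (verts G)) (\<lambda>Y. lagrangian G Y lam)"
  unfolding lagrangian_def
  by (intro diff2_on_add diff2_on_sum diff2_objective_hat
      diff2_on_compose[OF diff2_constraint diff2_on_linear[OF bounded_linear_inner_right, of UNIV]])
    auto

lemma constraint_in_vec_space:
  "v \<in> noninputs G \<Longrightarrow> Y \<in> cyl (verts G) \<Longrightarrow> constraint G v Y \<in> vec_space G {v}"
  using Phi_of_in_vec_space[of v Y] block_in_vec_space[of G "{v}" Y]
  by (auto simp: constraint_def vec_space_def)

lemma block_constraints:
  assumes "v \<in> noninputs G" "Y \<in> cyl (verts G)"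
  shows "block G {v} (constraints G Y) = constraint G v Y"
  unfolding constraints_def
  using assms by (subst block_sum_family) (auto intro: constraint_in_vec_space)

lemma constraints_in_vec_space:
  assumes "Y \<in> cyl (verts G)"
  shows "constraints G Y \<in> vec_space G (noninputs G)"
  unfolding constraints_def vec_space_iff_block
  using assms by (subst block_sum_family) (auto intro: constraint_in_vec_space)

text \<open>On the cylinder the constraint of \<open>v\<close> takes values in block
  \<open>v\<close>, so the blockwise pairings assemble into one inner product, whose derivative is
  \<open>lam\<close> paired with the derivative of \<open>constraints G\<close>.\<close>

lemma lagrangian_eq:
  assumes "Y \<in> cyl (verts G)"
  shows "lagrangian G Y lam = objective_hat G Y + lam \<bullet> constraints G Y"
proof -
  have "block G {v} lam \<bullet> constraint G v Y = lam \<bullet> constraint G v Y" if "v \<in> noninputs G" for v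
    using constraint_in_vec_space[OF that assms] by (simp add: inner_block vec_space_iff_block)
  then show ?thesis
    by (simp add: lagrangian_def constraints_def inner_sum_right)
qed

section \<open>The state map and its smoothness\<close>

lemma state_input: "v \<in> inputs G \<Longrightarrow> state G y v = block G {v} y"
  using dag by (simp add: state.simps[of G y v] inputs_def)

lemma state_noninput: "v \<in> noninputs G \<Longrightarrow> state G y v = Phi G v (\<Sum>z\<in>pa G v. state G y z)"
  using dag by (simp add: state.simps[of G y v] inputs_def noninputs_def)

lemma sum_states_in_cyl:
  assumes "A \<subseteq> verts G" "\<And>z. z \<in> A \<Longrightarrow> state G y z \<in> region G z"
  shows "(\<Sum>z\<in>A. state G y z) \<in> cyl A" "block G A (\<Sum>z\<in>A. state G y z) = (\<Sum>z\<in>A. state G y z)"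
proof -
  have *: "finite A" "\<And>z. z \<in> A \<Longrightarrow> state G y z \<in> vec_space G {z}"
    using finite_subset[OF assms(1)] assms region_subset by (auto dest: subsetD)
  show "(\<Sum>z\<in>A. state G y z) \<in> cyl A"
    unfolding cyl_def
    using assms(2) by (auto simp: block_sum_family[OF *] Int_absorb1)
  show "block G A (\<Sum>z\<in>A. state G y z) = (\<Sum>z\<in>A. state G y z)"
    by (simp add: block_sum_family[OF *])
qed

lemma state_in_region: "y \<in> cyl (inputs G) \<Longrightarrow> v \<in> verts G \<Longrightarrow> state G y v \<in> region G v"
proof (induction v rule: dag_induct[OF dag])
  case (1 v)
  show ?case
  proof (cases "v \<in> inputs G")
    case True
    then show ?thesis
      using 1(2) by (simp add: state_input cyl_def)
  next
    case False
    then have v: "v \<in> noninputs G"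
      using 1(3) by (simp add: noninputs_def)
    have "\<And>z. z \<in> pa G v \<Longrightarrow> state G y z \<in> region G z"
      using 1 pa_subset by blast
    note S = sum_states_in_cyl[OF pa_subset this]
    show ?thesis
      using Phi_of_in_region[OF v S(1)] S(2) v by (simp add: Phi_of_def state_noninput)
  qed
qed

lemma state_in_vec_space: "y \<in> cyl (inputs G) \<Longrightarrow> v \<in> verts G \<Longrightarrow> state G y v \<in> vec_space G {v}"
  using state_in_region region_subset by blast

lemma all_states_in_cyl: "y \<in> cyl (inputs G) \<Longrightarrow> all_states G y \<in> cyl (verts G)"
  unfolding all_states_def by (intro sum_states_in_cyl state_in_region) auto

lemma block_all_states:
  "y \<in> cyl (inputs G) \<Longrightarrow> block G A (all_states G y) = (\<Sum>v\<in>verts G \<inter> A. state G y v)"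
  unfolding all_states_def by (intro block_sum_family state_in_vec_space) auto

lemma constraint_all_states:
  assumes "y \<in> cyl (inputs G)" "v \<in> noninputs G"
  shows "constraint G v (all_states G y) = 0"
proof -
  have "verts G \<inter> pa G v = pa G v" "verts G \<inter> {v} = {v}"
    using pa_subset noninputs_subset assms(2) by auto
  then show ?thesis
    using assms by (simp add: constraint_def Phi_of_def block_all_states state_noninput)
qed

lemma constraints_all_states: "y \<in> cyl (inputs G) \<Longrightarrow> constraints G (all_states G y) = 0"
  by (simp add: constraints_def constraint_all_states)

lemma objective_eq_lagrangian:
  "y \<in> cyl (inputs G) \<Longrightarrow> objective G y = lagrangian G (all_states G y) lam"
  by (simp add: lagrangian_def objective_def objective_hat_def constraint_all_states)

text \<open>The complement of the non-inputs covers the padding as well as the inputs, and the state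
  map vanishes on padding. A vector that is zero on this complement therefore lies in
  \<open>vec_space G (noninputs G)\<close>.\<close>

lemma block_inputs_all_states:
  assumes "y \<in> cyl (inputs G)"
  shows "block G (- noninputs G) (all_states G y) = block G (inputs G) y"
proof -
  have "verts G \<inter> - noninputs G = inputs G"
    using inputs_subset by (auto simp: noninputs_def)
  then show ?thesis
    using assms finite_subset[OF inputs_subset]
    by (simp add: block_all_states state_input sum_block)
qed

text \<open>Induction along the DAG: a non-input state is \<open>Phi_of G v\<close> composed with
  the sum of the parent states, so smoothness passes from the parents to \<open>v\<close> by the
  chain rule.\<close>

lemma diff2_state: "v \<in> verts G \<Longrightarrow> diff2_on (cyl (inputs G)) (\<lambda>y. state G y v)"
proof (induction v rule: dag_induct[OF dag])
  case (1 v)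
  show ?case
  proof (cases "v \<in> inputs G")
    case True
    then show ?thesis
      by (simp add: state_input diff2_on_linear bounded_linear_block)
  next
    case False
    then have v: "v \<in> noninputs G"
      using 1(2) by (simp add: noninputs_def)
    have S: "(\<Sum>z\<in>pa G v. state G y z) \<in> cyl (pa G v)"
      "block G (pa G v) (\<Sum>z\<in>pa G v. state G y z) = (\<Sum>z\<in>pa G v. state G y z)"
      if "y \<in> cyl (inputs G)" for y
      using that pa_subset by (auto intro!: sum_states_in_cyl state_in_region)
    have "diff2_on (cyl (inputs G)) (\<lambda>y. Phi_of G v (\<Sum>z\<in>pa G v. state G y z))"
      by (rule diff2_on_compose[OF diff2_on_sum diff2_Phi_of[OF v]]) (use 1 pa_subset S in blast)+
    then show ?thesis
      by (rule diff2_on_cong[OF open_cyl[OF inputs_subset], rotated])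
        (simp add: Phi_of_def S state_noninput[OF v])
  qed
qed

lemma diff2_all_states: "diff2_on (cyl (inputs G)) (all_states G)"
  unfolding all_states_def[abs_def] by (intro diff2_on_sum diff2_state)

lemma feasible_in_cyl: "feasible G X \<Longrightarrow> X \<in> cyl (verts G)"
  by (simp add: feasible_def states_def cyl_def)

lemma input_block_in_cyl: "feasible G X \<Longrightarrow> block G (inputs G) X \<in> cyl (inputs G)"
  using feasible_in_cyl inputs_subset by (fastforce simp: cyl_def block_block)

text \<open>Feasibility is the forward recursion itself, so propagating the inputs of
  \<open>X\<close> reproduces every block of \<open>X\<close>, parents first; \<open>X\<close> has
  no padding part.\<close>

lemma all_states_feasible:
  assumes "feasible G X"
  shows "all_states G (block G (inputs G) X) = X"
proof -
  let ?x = "block G (inputs G) X"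
  have state: "state G ?x v = block G {v} X" if "v \<in> verts G" for v
    using that
  proof (induction v rule: dag_induct[OF dag])
    case (1 v)
    show ?case
    proof (cases "v \<in> inputs G")
      case True
      then show ?thesis
        by (simp add: state_input block_block)
    next
      case False
      then have v: "v \<in> noninputs G"
        using 1(2) by (simp add: noninputs_def)
      have "(\<Sum>z\<in>pa G v. state G ?x z) = (\<Sum>z\<in>pa G v. block G {z} X)"
        using 1 pa_subset by (intro sum.cong) auto
      also have "\<dots> = block G (pa G v) X"
        using finite_subset[OF pa_subset] by (simp add: sum_block)
      finally show ?thesis
        using assms v by (simp add: state_noninput feasible_def Phi_of_def)
    qed
  qed
  have "X \<in> vec_space G (verts G)"
    using assms by (simp add: feasible_def states_def)
  then show ?thesis
    by (simp add: all_states_def state sum_block vec_space_iff_block)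
qed

section \<open>Derivatives at a point\<close>

lemma Phi_of_derivative_independent:
  assumes "(Phi_of G d has_derivative D) (at Y)" "block G (pa G d) e = 0"
  shows "D e = 0"
  by (rule derivative_along_constant_line[OF assms(1)])
    (simp add: Phi_of_def block_add block_scaleR assms(2))

lemma loss_of_derivative_independent:
  assumes "(loss_of G s has_derivative D) (at Y)" "block G (fam G s) e = 0"
  shows "D e = 0"
  by (rule derivative_along_constant_line[OF assms(1)])
    (simp add: loss_of_def block_add block_scaleR assms(2))

text \<open>Matrices and gradients live on the whole of \<open>real ^ 'n\<close>, so directions
  \<open>e\<close> supported on padding have to be controlled too: neither block \<open>v\<close>
  nor the parent blocks see them.\<close>

lemma constraint_padding:
  assumes "v \<in> verts G" "block G (verts G) e = 0"
  shows "constraint G v (Y + e) = constraint G v Y"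
  using assms(1) pa_subset[of v] block_zero_subset[OF assms(2)]
  by (simp add: constraint_def Phi_of_def block_add)

lemma objective_hat_padding:
  assumes "block G (verts G) e = 0"
  shows "objective_hat G (Y + e) = objective_hat G Y"
  using pa_subset block_zero_subset[OF assms]
  by (simp add: objective_hat_def loss_of_def block_add)

lemma lagrangian_padding:
  assumes "block G (verts G) e = 0"
  shows "lagrangian G (Y + e) lam = lagrangian G Y lam"
proof -
  have "constraint G v (Y + e) = constraint G v Y" if "v \<in> noninputs G" for v
    using that noninputs_subset assms by (intro constraint_padding) auto
  then show ?thesis
    using assms by (simp add: lagrangian_def objective_hat_padding)
qed

lemma constraints_padding:
  assumes "block G (verts G) e = 0"
  shows "constraints G (Y + e) = constraints G Y"
  unfolding constraints_def
  using noninputs_subset assms by (intro sum.cong constraint_padding) auto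

text \<open>In the non-input coordinates the constraint Jacobian is block triangular along the DAG
  with minus the identity on the diagonal. Once the parent blocks of \<open>e\<close> are zero,
  block \<open>v\<close> of \<open>D e = 0\<close> reduces to
  \<open>- block G {v} e = 0\<close>.\<close>

lemma constraints_derivative_injective:
  assumes "Y \<in> cyl (verts G)" "(constraints G has_derivative D) (at Y)"
    "e \<in> vec_space G (noninputs G)" "D e = 0"
  shows "e = 0"
proof -
  have block_e: "block G {v} e = 0" for v
  proof (induction v rule: dag_induct[OF dag])
    case (1 v)
    show ?case
    proof (cases "v \<in> noninputs G")
      case False
      then show ?thesis
        using assms(3) by (auto intro: block_vec_space_disjoint)
    next
      case v: True
      have "Y \<in> cyl (pa G v)"
        using assms(1) cyl_antimono[OF pa_subset] by blast
      then obtain P where P: "(Phi_of G v has_derivative P) (at Y)"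
        using diff2_Phi_of[OF v] by (meson diff2_on_imp_has_derivative)
      \<comment> \<open>Near \<open>Y\<close>, block \<open>v\<close> of the concatenated
        constraints is the constraint of \<open>v\<close>. Differentiating it in two ways isolates
        row \<open>v\<close> of \<open>D\<close>.\<close>
      have "((\<lambda>Y. block G {v} (constraints G Y)) has_derivative (\<lambda>h. block G {v} (D h))) (at Y)"
        by (rule bounded_linear.has_derivative[OF bounded_linear_block assms(2)])
      then have "(constraint G v has_derivative (\<lambda>h. block G {v} (D h))) (at Y)"
        by (rule has_derivative_transform_within_open[OF _ open_cyl[OF subset_refl] assms(1)])
          (simp add: block_constraints v)
      moreover have "(constraint G v has_derivative (\<lambda>h. P h - block G {v} h)) (at Y)"
        unfolding constraint_def[abs_def]
        by (intro has_derivative_diff P bounded_linear_imp_has_derivative bounded_linear_block)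
      ultimately have "(\<lambda>h. block G {v} (D h)) = (\<lambda>h. P h - block G {v} h)"
        by (rule has_derivative_unique)
      then have "block G {v} (D e) = P e - block G {v} e"
        by (rule fun_cong)
      moreover have "block G (pa G v) e = (\<Sum>z\<in>pa G v. block G {z} e)"
        using finite_subset[OF pa_subset] by (simp add: sum_block)
      then have "block G (pa G v) e = 0"
        using 1 by simp
      then have "P e = 0"
        by (rule Phi_of_derivative_independent[OF P])
      ultimately show ?thesis
        using assms(4) by (simp add: block_zero)
    qed
  qed
  have "e = (\<Sum>v\<in>noninputs G. block G {v} e)"
    using assms(3) by (simp add: sum_block vec_space_iff_block)
  then show ?thesis
    by (simp add: block_e)
qed

text \<open>Pairing the backward recursion with a direction in block \<open>v\<close> moves each
  transpose to the other side, where it becomes the derivative \<open>P d\<close> applied to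
  \<open>e\<close>.\<close>

lemma inner_total_deriv:
  assumes "Y \<in> cyl (verts G)" "e \<in> vec_space G {v}"
    and "\<And>d. d \<in> noninputs G \<Longrightarrow> (Phi_of G d has_derivative P d) (at Y)"
  shows "e \<bullet> total_deriv G Y v =
    (\<Sum>s\<in>insert v (ch G v). e \<bullet> gradient (loss_of G s) Y)
    + (\<Sum>d\<in>ch G v. total_deriv G Y d \<bullet> P d e)"
proof -
  have loss: "e \<bullet> partial_grad_loss G v s Y = e \<bullet> gradient (loss_of G s) Y" for s
    using assms(2) by (simp add: partial_grad_loss_def vec_space_iff_block flip: inner_block)
  have Phi: "e \<bullet> (transpose (partial_jac_Phi G v d Y) *v t) = t \<bullet> P d e" if "d \<in> ch G v" for d t
  proof -
    \<comment> \<open>Masking the columns outside block \<open>v\<close> changes nothing, since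
      \<open>e\<close> has entries in block \<open>v\<close> only.\<close>
    have "partial_jac_Phi G v d Y *v e = jacobian (Phi_of G d) (at Y) *v e"
      using assms(2)
      by (auto simp: partial_jac_Phi_def matrix_vector_mult_def vec_eq_iff vec_space_def
          intro!: sum.cong)
    also have "\<dots> = P d e"
      using that ch_subset by (auto intro: jacobian_mult assms(3))
    finally show ?thesis
      by (simp only: inner_transpose_mult)
  qed
  show ?thesis
    unfolding total_deriv.simps[of G Y v] using dag
    by (simp add: inner_add_right inner_sum_right loss Phi del: transpose_matrix_vector)
qed

text \<open>In block \<open>v\<close> the derivative of the Lagrangian collects the gradients of the
  losses of \<open>v\<close> and its children, the terms \<open>P d\<close> weighted by the
  multipliers of the children, and minus the multiplier of \<open>v\<close>. The reverse-mode
  recursion says exactly that these cancel.\<close>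

lemma lagrangian_stationary:
  assumes "Y \<in> cyl (verts G)"
    and lam: "\<And>v. v \<in> noninputs G \<Longrightarrow> block G {v} lam = total_deriv G Y v"
    and D: "((\<lambda>Y. lagrangian G Y lam) has_derivative D) (at Y)"
    and e: "e \<in> vec_space G (noninputs G)"
  shows "D e = 0"
proof -
  have "\<exists>P. (Phi_of G d has_derivative P) (at Y)" if "d \<in> noninputs G" for d
  proof -
    have "Y \<in> cyl (pa G d)"
      using assms(1) cyl_antimono[OF pa_subset] by blast
    then show ?thesis
      using diff2_Phi_of[OF that] by (meson diff2_on_imp_has_derivative)
  qed
  then obtain P where P: "\<And>d. d \<in> noninputs G \<Longrightarrow> (Phi_of G d has_derivative P d) (at Y)"
    by metis
  have "\<exists>g. (loss_of G s has_derivative g) (at Y)" if "s \<in> verts G" for s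
    using diff2_loss_of[OF that] assms(1) by (meson diff2_on_imp_has_derivative)
  then obtain g where g: "\<And>s. s \<in> verts G \<Longrightarrow> (loss_of G s has_derivative g s) (at Y)"
    by metis
  have "((\<lambda>Y. lagrangian G Y lam) has_derivative (\<lambda>h. (\<Sum>s\<in>verts G. g s h)
      + (\<Sum>d\<in>noninputs G. block G {d} lam \<bullet> (P d h - block G {d} h)))) (at Y)"
    unfolding lagrangian_def objective_hat_def constraint_def
    by (intro has_derivative_add has_derivative_sum has_derivative_inner_right has_derivative_diff
        g P bounded_linear_imp_has_derivative bounded_linear_block)
  then have D_eq: "D = (\<lambda>h. (\<Sum>s\<in>verts G. g s h)
      + (\<Sum>d\<in>noninputs G. block G {d} lam \<bullet> (P d h - block G {d} h)))"
    by (rule has_derivative_unique[OF D])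
  \<comment> \<open>By linearity of \<open>D\<close> it suffices to treat directions in a single
    block. The sums over all vertices then shrink to \<open>v\<close> and its children, the only
    ones whose functions read block \<open>v\<close>.\<close>
  have zero: "D h = 0" if v: "v \<in> noninputs G" and h: "h \<in> vec_space G {v}" for v h
  proof -
    have "(\<Sum>s\<in>verts G. g s h) = (\<Sum>s\<in>insert v (ch G v). g s h)"
    proof (rule sum.mono_neutral_right)
      show "insert v (ch G v) \<subseteq> verts G"
        using v ch_subset noninputs_subset by blast
      show "\<forall>s\<in>verts G - insert v (ch G v). g s h = 0"
      proof
        fix s assume s: "s \<in> verts G - insert v (ch G v)"
        then have "block G (fam G s) h = 0"
          using h by (auto intro!: block_vec_space_disjoint simp: in_pa_iff_in_ch)
        then show "g s h = 0"
          using s by (intro loss_of_derivative_independent[OF g]) auto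
      qed
    qed simp
    also have "\<dots> = (\<Sum>s\<in>insert v (ch G v). h \<bullet> gradient (loss_of G s) Y)"
      using v ch_subset noninputs_subset by (intro sum.cong refl inner_gradient[OF g, symmetric]) blast
    finally have 1: "(\<Sum>s\<in>verts G. g s h) =
      (\<Sum>s\<in>insert v (ch G v). h \<bullet> gradient (loss_of G s) Y)" .
    have "(\<Sum>d\<in>noninputs G. block G {d} lam \<bullet> P d h) = (\<Sum>d\<in>ch G v. block G {d} lam \<bullet> P d h)"
    proof (rule sum.mono_neutral_right)
      show "\<forall>d\<in>noninputs G - ch G v. block G {d} lam \<bullet> P d h = 0"
      proof
        fix d assume d: "d \<in> noninputs G - ch G v"
        then have "block G (pa G d) h = 0"
          using h by (auto intro!: block_vec_space_disjoint simp: in_pa_iff_in_ch)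
        then have "P d h = 0"
          using d by (intro Phi_of_derivative_independent[OF P]) auto
        then show "block G {d} lam \<bullet> P d h = 0" by simp
      qed
    qed (use ch_subset in auto)
    also have "\<dots> = (\<Sum>d\<in>ch G v. total_deriv G Y d \<bullet> P d h)"
      by (intro sum.cong refl) (metis lam ch_subset subsetD)
    finally have 2: "(\<Sum>d\<in>noninputs G. block G {d} lam \<bullet> P d h) =
      (\<Sum>d\<in>ch G v. total_deriv G Y d \<bullet> P d h)" .
    \<comment> \<open>Block \<open>v\<close> is subtracted only in the constraint of
      \<open>v\<close> itself, which leaves the single multiplier
      \<open>total_deriv G Y v\<close>.\<close>
    have "(\<Sum>d\<in>noninputs G. block G {d} lam \<bullet> block G {d} h) =
      (\<Sum>d\<in>noninputs G. if d = v then h \<bullet> total_deriv G Y v else 0)"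
    proof (rule sum.cong)
      fix d
      show "block G {d} lam \<bullet> block G {d} h = (if d = v then h \<bullet> total_deriv G Y v else 0)"
        using h lam[OF v]
        by (auto simp: block_vec_space_disjoint block_vec_space_subset inner_commute)
    qed simp
    then have 3: "(\<Sum>d\<in>noninputs G. block G {d} lam \<bullet> block G {d} h) = h \<bullet> total_deriv G Y v"
      using v by simp
    show ?thesis
      using inner_total_deriv[OF assms(1) h P]
      by (simp add: D_eq inner_diff_right sum_subtractf 1 2 3)
  qed
  have "e = (\<Sum>v\<in>noninputs G. block G {v} e)"
    using e by (simp add: sum_block vec_space_iff_block)
  then have "D e = D (\<Sum>v\<in>noninputs G. block G {v} e)"
    by simp
  also have "\<dots> = (\<Sum>v\<in>noninputs G. D (block G {v} e))"
    by (rule linear_sum[OF has_derivative_linear[OF D]])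
  finally show ?thesis
    by (simp add: zero block_in_vec_space)
qed

section \<open>Equivalence of the Newton equation and the KKT system\<close>

lemma newton_iff_kkt:
  assumes feas: "feasible G X"
    and lam: "\<And>v. v \<in> noninputs G \<Longrightarrow> block G {v} lam = total_deriv G X v"
    and u: "u \<in> vec_space G (inputs G)"
  shows "newton_equation G (block G (inputs G) X) u \<longleftrightarrow>
    (\<exists>dX lamp. kkt_solution G X lam dX lamp \<and> block G (inputs G) dX = u)"
proof -
  let ?x = "block G (inputs G) X" and ?D = "cyl (verts G)" and ?I = "cyl (inputs G)"
    and ?L = "\<lambda>Y. lagrangian G Y lam" and ?N = "noninputs G"
  note X = feasible_in_cyl[OF feas] and x = input_block_in_cyl[OF feas]
    and Sx = all_states_feasible[OF feas]
  note open_D = open_cyl[OF subset_refl] and open_I = open_cyl[OF inputs_subset]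
  obtain S' S'' where S': "\<And>y. y \<in> ?I \<Longrightarrow> (all_states G has_derivative blinfun_apply (S' y)) (at y)"
    and S'': "\<And>y. y \<in> ?I \<Longrightarrow> (S' has_derivative blinfun_apply (S'' y)) (at y)"
    using diff2_all_states unfolding diff2_on_def by blast
  obtain L' L'' where L': "\<And>Y. Y \<in> ?D \<Longrightarrow> (?L has_derivative blinfun_apply (L' Y)) (at Y)"
    and L'': "\<And>Y. Y \<in> ?D \<Longrightarrow> (L' has_derivative blinfun_apply (L'' Y)) (at Y)"
    using diff2_lagrangian unfolding diff2_on_def by blast
  obtain H where H: "(constraints G has_derivative H) (at X)"
    using diff2_constraints X by (meson diff2_on_imp_has_derivative)
  obtain F where F: "(objective_hat G has_derivative F) (at X)"
    using diff2_objective_hat X by (meson diff2_on_imp_has_derivative)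
  define T where "T = blinfun_apply (S' ?x)"
  have T: "(all_states G has_derivative T) (at ?x)"
    unfolding T_def by (rule S'[OF x])
  \<comment> \<open>The objective is differentiated through the Lagrangian with \<open>lam\<close>
    held fixed; the factored form is the one that \<open>has_derivative_blinfun_chain\<close>
    differentiates again.\<close>
  define f' where "f' y = L' (all_states G y) o\<^sub>L S' y" for y
  have f': "(objective G has_derivative blinfun_apply (f' y)) (at y)" if y: "y \<in> ?I" for y
  proof -
    have "((\<lambda>y. ?L (all_states G y)) has_derivative blinfun_apply (f' y)) (at y)"
      using has_derivative_compose[OF S'[OF y] L'[OF all_states_in_cyl[OF y]]]
      by (simp add: f'_def blinfun_compose.rep_eq o_def)
    then show ?thesis
      by (rule has_derivative_transform_within_open[OF _ open_I y])
        (rule objective_eq_lagrangian[symmetric])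
  qed

  \<comment> \<open>The constraints vanish identically along the state map; differentiating this
    identity puts the range of \<open>T\<close> inside the kernel of \<open>H\<close>.\<close>
  have HT: "H (T w) = 0" for w
  proof -
    have "((\<lambda>y. constraints G (all_states G y)) has_derivative (\<lambda>w. H (T w))) (at ?x)"
      using H by (intro has_derivative_compose[OF T]) (simp add: Sx)
    then have "((\<lambda>y. 0) has_derivative (\<lambda>w. H (T w))) (at ?x)"
      by (rule has_derivative_transform_within_open[OF _ open_I x]) (rule constraints_all_states)
    then have "(\<lambda>w. H (T w)) = (\<lambda>w. 0)"
      by (rule has_derivative_unique) simp
    then show ?thesis by (rule fun_cong)
  qed
  have LF: "L' X h = F h + lam \<bullet> H h" for h
  proof -
    have "((\<lambda>Y. objective_hat G Y + lam \<bullet> constraints G Y) has_derivative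
        (\<lambda>h. F h + lam \<bullet> H h)) (at X)"
      by (intro has_derivative_add has_derivative_inner_right F H)
    then have "(?L has_derivative (\<lambda>h. F h + lam \<bullet> H h)) (at X)"
      by (rule has_derivative_transform_within_open[OF _ open_D X]) (simp add: lagrangian_eq)
    from has_derivative_unique[OF L'[OF X] this] show ?thesis
      by (rule fun_cong)
  qed
  have stationary: "L' X e = 0" if "e \<in> vec_space G ?N" for e
    by (rule lagrangian_stationary[OF X lam L'[OF X] that])

  \<comment> \<open>Shown for every \<open>y\<close> in the cylinder and not only at
    \<open>?x\<close>, because the identity is differentiated once more in \<open>y\<close>.\<close>
  have block_S': "block G (- ?N) (S' y w) = block G (inputs G) w" if y: "y \<in> ?I" for y w
  proof -
    have "((\<lambda>y. block G (- ?N) (all_states G y)) has_derivative (\<lambda>w. block G (- ?N) (S' y w))) (at y)"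
      by (rule bounded_linear.has_derivative[OF bounded_linear_block S'[OF y]])
    then have "(block G (inputs G) has_derivative (\<lambda>w. block G (- ?N) (S' y w))) (at y)"
      by (rule has_derivative_transform_within_open[OF _ open_I y]) (rule block_inputs_all_states)
    from has_derivative_unique[OF this bounded_linear_imp_has_derivative[OF bounded_linear_block]]
    show ?thesis by (rule fun_cong)
  qed
  \<comment> \<open>The input block of the state map is linear.\<close>
  have S''_noninput: "S'' ?x h w \<in> vec_space G ?N" for h w
  proof -
    have "((\<lambda>y. block G (- ?N) (S' y w)) has_derivative (\<lambda>h. block G (- ?N) (S'' ?x h w))) (at ?x)"
      by (intro bounded_linear.has_derivative[OF bounded_linear_block]
          bounded_linear.has_derivative[OF blinfun.bounded_linear_left] S''[OF x])
    then have "((\<lambda>y. block G (inputs G) w) has_derivative (\<lambda>h. block G (- ?N) (S'' ?x h w))) (at ?x)"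
      by (rule has_derivative_transform_within_open[OF _ open_I x]) (rule block_S')
    then have "(\<lambda>h. block G (- ?N) (S'' ?x h w)) = (\<lambda>h. 0)"
      by (rule has_derivative_unique) simp
    then have "block G (- ?N) (S'' ?x h w) = 0"
      by (rule fun_cong)
    then show ?thesis
      by (auto simp: vec_space_def vec_eq_iff split: if_splits)
  qed
  have block_T: "block G (- ?N) (T w) = block G (inputs G) w" for w
    unfolding T_def by (rule block_S'[OF x])
  \<comment> \<open>The converse inclusion. Subtracting \<open>T\<close> of the input block of
    \<open>d\<close> leaves a vector without input or padding part that is still in the kernel of
    \<open>H\<close>, and injectivity on the non-inputs makes it zero.\<close>
  have range_T: "T (block G (inputs G) d) = d" if d: "d \<in> vec_space G (verts G)" "H d = 0" for d
  proof -
    let ?e = "d - T (block G (inputs G) d)"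
    have "block G (- ?N) d = block G (inputs G) d"
      using d(1) inputs_subset by (auto simp: vec_eq_iff vec_space_def noninputs_def)
    then have "block G (- ?N) ?e = 0"
      by (simp add: block_diff block_T block_block)
    then have "?e \<in> vec_space G ?N"
      by (auto simp: vec_space_def vec_eq_iff split: if_splits)
    moreover have "H ?e = 0"
      by (simp add: linear_diff[OF has_derivative_linear[OF H]] d(2) HT)
    ultimately have "?e = 0"
      by (rule constraints_derivative_injective[OF X H])
    then show ?thesis by simp
  qed

  have hess_L: "k \<bullet> (hessian ?L X *v d) = L'' X d k" for k d
    by (rule inner_hessian[OF open_D X L' L''[OF X]])
  have "(f' has_derivative
      (\<lambda>h. (L' X o\<^sub>L S'' ?x h) + (L'' X (T h) o\<^sub>L S' ?x))) (at ?x)"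
    unfolding f'_def[abs_def] T_def
    using has_derivative_blinfun_chain[OF S'[OF x] S''[OF x] L''[OF all_states_in_cyl[OF x]]]
    by (simp add: Sx)
  \<comment> \<open>The summand \<open>L' X (S'' ?x h w)\<close> drops out: \<open>S''\<close> has
    only non-input components, and \<open>L' X\<close> annihilates these by stationarity.\<close>
  from inner_hessian[OF open_I x f' this]
  have hess_f: "w \<bullet> (hessian (objective G) ?x *v h) = L'' X (T h) (T w)" for w h
    using stationary[OF S''_noninput] by (simp add: plus_blinfun.rep_eq T_def)
  \<comment> \<open>By \<open>LF\<close> the derivatives of the Lagrangian and of
    \<open>objective_hat G\<close> differ by \<open>lam\<close> paired with \<open>H\<close>, which
    is zero on the range of \<open>T\<close>.\<close>
  have grad_f: "w \<bullet> gradient (objective G) ?x = F (T w)" for w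
    using inner_gradient[OF f'[OF x]] by (simp add: f'_def Sx LF HT flip: T_def)
  have newton: "newton_equation G ?x u \<longleftrightarrow> (\<forall>w. L'' X (T u) (T w) = - F (T w))"
    unfolding newton_equation_def
    by (subst vector_eq_ldot[symmetric]) (simp add: hess_f grad_f)

  have grad_F: "k \<bullet> gradient (objective_hat G) X = F k" for k
    by (rule inner_gradient[OF F])
  let ?J = "jacobian (constraints G) (at X)"
  have J: "?J *v h = H h" for h
    by (rule jacobian_mult[OF H])
  have JT: "k \<bullet> (transpose ?J *v l) = l \<bullet> H k" for k l
    by (simp only: inner_transpose_mult J)
  have H_noninput: "H k \<in> vec_space G ?N" for k
  proof -
    have "((\<lambda>Y. block G ?N (constraints G Y)) has_derivative (\<lambda>k. block G ?N (H k))) (at X)"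
      by (rule bounded_linear.has_derivative[OF bounded_linear_block H])
    then have "(constraints G has_derivative (\<lambda>k. block G ?N (H k))) (at X)"
      by (rule has_derivative_transform_within_open[OF _ open_D X])
        (use constraints_in_vec_space in \<open>simp add: vec_space_iff_block\<close>)
    from has_derivative_unique[OF this H] show ?thesis
      unfolding vec_space_iff_block by (rule fun_cong)
  qed
  have constraints_X: "constraints G X = 0"
    using constraints_all_states[OF x] by (simp add: Sx)

  show ?thesis
  proof
    assume "\<exists>dX lamp. kkt_solution G X lam dX lamp \<and> block G (inputs G) dX = u"
    then obtain d l where kkt: "kkt_solution G X lam d l" and du: "block G (inputs G) d = u"
      by blast
    \<comment> \<open>At a feasible point the right-hand side of the second KKT row is zero, so
      \<open>d\<close> is tangent to the constraints and is recovered from its input block.\<close>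
    have "H d = 0"
      using kkt by (simp add: kkt_solution_def J constraints_X)
    then have Tu: "T u = d"
      using range_T kkt du by (auto simp: kkt_solution_def)
    have "L'' X d k + l \<bullet> H k = - F k" for k
    proof -
      have "k \<bullet> (hessian ?L X *v d + transpose ?J *v l) = k \<bullet> - gradient (objective_hat G) X"
        using kkt by (simp add: kkt_solution_def)
      then show ?thesis
        by (simp add: inner_add_right hess_L JT grad_F del: transpose_matrix_vector)
    qed
    \<comment> \<open>Testing the first KKT row against tangent vectors eliminates the multiplier,
      since \<open>H (T w) = 0\<close>.\<close>
    from this[of "T _"] show "newton_equation G ?x u"
      by (simp add: newton Tu HT)
  next
    assume N: "newton_equation G ?x u"
    \<comment> \<open>For \<open>L''\<close> padding is handled in the second slot:
      \<open>L' Y k = 0\<close> for all \<open>Y\<close> in the cylinder, and differentiating this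
      in \<open>Y\<close> gives the claim for every \<open>d\<close>.\<close>
    have padding: "F k = 0" "H k = 0" "L'' X d k = 0" if k: "block G (verts G) k = 0" for k d
    proof -
      have tk: "block G (verts G) (t *\<^sub>R k) = 0" for t
        using k by (simp add: block_scaleR)
      show "F k = 0"
        by (rule derivative_along_constant_line[OF F]) (rule objective_hat_padding[OF tk])
      show "H k = 0"
        by (rule derivative_along_constant_line[OF H]) (rule constraints_padding[OF tk])
      have "((\<lambda>Y. L' Y k) has_derivative (\<lambda>d. L'' X d k)) (at X)"
        by (rule bounded_linear.has_derivative[OF blinfun.bounded_linear_left L''[OF X]])
      then have "((\<lambda>Y. 0) has_derivative (\<lambda>d. L'' X d k)) (at X)"
        by (rule has_derivative_transform_within_open[OF _ open_D X])
          (rule derivative_along_constant_line[OF L' lagrangian_padding[OF tk]])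
      then have "(\<lambda>d. L'' X d k) = (\<lambda>d. 0)"
        by (rule has_derivative_unique) simp
      then show "L'' X d k = 0"
        by (rule fun_cong)
    qed
    \<comment> \<open>The residual of the first KKT row at \<open>T u\<close> without its multiplier
      term; it remains to show that it lies in the range of the transposed Jacobian.\<close>
    define r where "r = - gradient (objective_hat G) X - hessian ?L X *v T u"
    have r: "k \<bullet> r = - F k - L'' X (T u) k" for k
      by (simp add: r_def inner_diff_right grad_F hess_L)
    have "k \<bullet> r = 0" if "?J *v k = 0" for k
    proof -
      \<comment> \<open>A kernel vector may carry padding, which \<open>range_T\<close> does not
        cover. The graph part is tangent and is handled by the Newton equation; the padding part
        pairs to zero with \<open>r\<close>.\<close>
      let ?k = "block G (verts G) k"
      have "block G (verts G) (k - ?k) = 0"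
        by (simp add: block_diff block_block)
      note pad = padding[OF this]
      have "H ?k = 0"
        using pad(2) that by (simp add: linear_diff[OF has_derivative_linear[OF H]] J)
      then have "?k = T (block G (inputs G) ?k)"
        using range_T block_in_vec_space by metis
      then have "?k \<bullet> r = 0"
        using N newton r by (metis diff_self)
      moreover have "(k - ?k) \<bullet> r = 0"
        unfolding r pad by simp
      ultimately show ?thesis
        by (simp add: inner_diff_left)
    qed
    then obtain l where l: "transpose ?J *v l = r"
      using range_transpose_eq_kernel_orthogonal by blast
    \<comment> \<open>The multiplier \<open>l\<close> may have entries outside the non-inputs, but
      \<open>kkt_solution\<close> asks for \<open>vec_space G ?N\<close>. Truncation is harmless
      because \<open>H\<close> takes values in the non-input blocks.\<close>
    have "transpose ?J *v block G ?N l = transpose ?J *v l"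
      using H_noninput
      by (subst vector_eq_ldot[symmetric])
        (simp add: JT inner_block vec_space_iff_block del: transpose_matrix_vector)
    then have "hessian ?L X *v T u + transpose ?J *v block G ?N l = - gradient (objective_hat G) X"
      by (simp add: l r_def del: transpose_matrix_vector)
    moreover have "T u \<in> vec_space G (verts G)" "block G (inputs G) (T u) = u"
    proof -
      \<comment> \<open>Outside the non-inputs \<open>T u\<close> agrees with \<open>u\<close>,
        which is supported on the inputs. This yields both the input block of \<open>T u\<close> and
        the vanishing of its padding.\<close>
      have b: "block G (- ?N) (T u) = u"
        using u by (simp add: block_T vec_space_iff_block)
      have "block G A (T u) = block G A u" if "A \<subseteq> - ?N" for A
        using that b by (metis block_block inf.absorb1)
      from this[of "- verts G"] this[of "inputs G"]
      have *: "block G (- verts G) (T u) = block G (- verts G) u"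
        "block G (inputs G) (T u) = block G (inputs G) u"
        using noninputs_subset by (auto simp: noninputs_def)
      show "block G (inputs G) (T u) = u"
        using * u by (simp add: vec_space_iff_block)
      have "block G (- verts G) (T u) = 0"
        using * u inputs_subset by (auto intro: block_vec_space_disjoint)
      then show "T u \<in> vec_space G (verts G)"
        by (auto simp: vec_space_def vec_eq_iff split: if_splits)
    qed
    ultimately have "kkt_solution G X lam (T u) (block G ?N l) \<and> block G (inputs G) (T u) = u"
      by (simp add: kkt_solution_def block_in_vec_space J HT constraints_X del: transpose_matrix_vector)
    then show "\<exists>dX lamp. kkt_solution G X lam dX lamp \<and> block G (inputs G) dX = u"
      by blast
  qed
qed

end

theorem theorem1:
  fixes G :: "('v, 'n::finite) comp_structure"
    and X lam dX_input :: "real ^ 'n"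
  assumes "comp_structure G"
    and "C2_structure G"
    and "feasible G X"
    and "lam \<in> vec_space G (noninputs G)"
    and "\<And>v. v \<in> noninputs G \<Longrightarrow> block G {v} lam = total_deriv G X v"
    and "dX_input \<in> vec_space G (inputs G)"
  shows "newton_equation G (block G (inputs G) X) dX_input \<longleftrightarrow>
    (\<exists>dX lamp. kkt_solution G X lam dX lamp \<and> block G (inputs G) dX = dX_input)"
proof -
  interpret c2_comp_structure G
    using assms(1,2) by unfold_locales
  show ?thesis
    by (rule newton_iff_kkt[OF assms(3,5,6)])
qed

end
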